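(* Let $q$ be a prime power and let $n,k\ge 1$ and $0\le u,t\le n$ be integers with $u+t<n$. Let $\mathcal{C}$ be an $[n,k,d]_q$ linear code with $d\ge 2(t+u)+1$. Suppose the encoder works as follows: given a set $\phi\subseteq\{0,\dots,n-1\}$ with $|\phi|=u$ and a message, it takes the codeword $\boldsymbol{c}'\in\mathcal{C}$ corresponding to the message (under a fixed bijection between the $q^k$ messages and $\mathcal{C}$) and changes entries of $\boldsymbol{c}'$ only at positions in $\phi$ (introducing artificial errors there), obtaining a word $\boldsymbol{c}\in\mathbb{F}_q^n$ such that $c_i+e_i\ne 0$ for all $i\in\phi$ and all admissible error vectors $\boldsymbol{e}$. Then, together with a suitable decoder, this encoder forms an $(n,q^k)_q$ $(u,t)$-PDMC.
   Context: All arithmetic is in the finite field $\mathbb{F}_q$. An $[n,k,d]_q$ code is a $k$-dimensional linear subspace of $\mathbb{F}_q^n$ with minimum Hamming distance $d$. A cell is partially defective at level $1$ if it can store every value of $\mathbb{F}_q$ except $0$. Admissible error vectors are $\boldsymbol{e}\in\{0,1\}^n\subseteq\mathbb{F}_q^n$ of Hamming weight at most $t$; errors may occur at any position, including the partially defective positions. An $(n,M)_q$ $(u,t)$-PDMC (code for partially defective memory cells) is a pair (encoder $\mathcal{E}$, decoder $\mathcal{D}$) with a message set $\mathcal{M}$ of size $M$ such that: $\mathcal{E}$ takes a set $\phi\subseteq\{0,\dots,n-1\}$ of $u$ positions (cells partially defective at level $1$) and a message $\boldsymbol{m}\in\mathcal{M}$, and outputs $\boldsymbol{c}\in\mathbb{F}_q^n$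 such that for every admissible error vector $\boldsymbol{e}$ one has $c_i+e_i\neq 0$ for all $i\in\phi$; and $\mathcal{D}$, which is given only $\boldsymbol{c}+\boldsymbol{e}$ (not $\phi$), returns $\boldsymbol{m}$ for every admissible $\boldsymbol{e}$. *)

theory Defs
  imports "HOL-Analysis.Cartesian_Space"
begin

text \<open>
  Words over a finite field are vectors \<open>'a ^ 'n\<close>; the field size is \<open>CARD('a)\<close> and the
  positions \<open>0, \<dots>, n - 1\<close> are the elements of the index type \<open>'n\<close>, with \<open>n = CARD('n)\<close>.
\<close>

definition hamming_weight :: "'a::zero ^ 'n \<Rightarrow> nat" where
  "hamming_weight x = card {i. x $ i \<noteq> 0}"

definition hamming_dist :: "'a ^ 'n \<Rightarrow> 'a ^ 'n \<Rightarrow> nat" where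
  "hamming_dist x y = card {i. x $ i \<noteq> y $ i}"

text \<open>The minimum is only meaningful for codes with at least two codewords.\<close>

definition min_hamming_dist :: "('a ^ 'n) set \<Rightarrow> nat" where
  "min_hamming_dist C = Min {hamming_dist x y |x y. x \<in> C \<and> y \<in> C \<and> x \<noteq> y}"

definition linear_code ::
  "nat \<Rightarrow> nat \<Rightarrow> nat \<Rightarrow> nat \<Rightarrow> ('a::{field,finite} ^ 'n) set \<Rightarrow> bool" where
  "linear_code q n k d C \<longleftrightarrow>
     CARD('a) = q \<and> CARD('n) = n \<and>
     vec.subspace C \<and> vec.dim C = k \<and> min_hamming_dist C = d"

definition admissible_error :: "nat \<Rightarrow> 'a::{field,finite} ^ 'n \<Rightarrow> bool" where
  "admissible_error t e \<longleftrightarrow> (\<forall>i. e $ i \<in> {0, 1}) \<and> hamming_weight e \<le> t"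

definition PDMC ::
  "nat \<Rightarrow> nat \<Rightarrow> nat \<Rightarrow> nat \<Rightarrow> nat \<Rightarrow> 'm set \<Rightarrow>
   ('n set \<Rightarrow> 'm \<Rightarrow> 'a::{field,finite} ^ 'n) \<Rightarrow> ('a ^ 'n \<Rightarrow> 'm) \<Rightarrow> bool" where
  "PDMC n M q u t Msgs Enc Dec \<longleftrightarrow>
     CARD('a) = q \<and> CARD('n) = n \<and> finite Msgs \<and> card Msgs = M \<and>
     (\<forall>\<phi> m e. card \<phi> = u \<longrightarrow> m \<in> Msgs \<longrightarrow> admissible_error t e \<longrightarrow>
        (\<forall>i\<in>\<phi>. Enc \<phi> m $ i + e $ i \<noteq> 0) \<and> Dec (Enc \<phi> m + e) = m)"

end

theory Submission
  imports Defs
begin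

text \<open>
  A received word differs from the stored codeword in at most \<open>u\<close> masked positions and \<open>t\<close> error
  positions. Since \<open>2 * (t + u) < d\<close>, the balls of radius \<open>t + u\<close> around codewords are disjoint,
  so decoding to a codeword in distance \<open>t + u\<close> is well defined, without knowledge of \<open>\<phi>\<close>.
\<close>

lemma hamming_dist_commute: "hamming_dist x y = hamming_dist y x"
  unfolding hamming_dist_def by (simp add: eq_commute)

lemma hamming_dist_triangle:
  fixes x y z :: "'a ^ 'n"
  shows "hamming_dist x z \<le> hamming_dist x y + hamming_dist y z"
proof -
  have "{i. x $ i \<noteq> z $ i} \<subseteq> {i. x $ i \<noteq> y $ i} \<union> {i. y $ i \<noteq> z $ i}"
    by auto
  then have "card {i. x $ i \<noteq> z $ i} \<le> card ({i. x $ i \<noteq> y $ i} \<union> {i. y $ i \<noteq> z $ i})"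
    by (intro card_mono) auto
  also have "\<dots> \<le> card {i. x $ i \<noteq> y $ i} + card {i. y $ i \<noteq> z $ i}"
    by (rule card_Un_le)
  finally show ?thesis
    unfolding hamming_dist_def .
qed

text \<open>\<open>Min\<close> is informative only on a finite set. The distances form one here:
  they lie in the image of \<open>C \<times> C\<close>, which is finite because both the alphabet
  and the index type are.\<close>

lemma min_hamming_dist_le:
  fixes C :: "('a::finite ^ 'n) set"
  assumes "x \<in> C" "y \<in> C" "x \<noteq> y"
  shows "min_hamming_dist C \<le> hamming_dist x y"
proof -
  have "{hamming_dist x y |x y. x \<in> C \<and> y \<in> C \<and> x \<noteq> y} \<subseteq> (\<lambda>(x, y). hamming_dist x y) ` (C \<times> C)"
    by (auto simp: image_iff)
  then have "finite {hamming_dist x y |x y. x \<in> C \<and> y \<in> C \<and> x \<noteq> y}"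
    by (rule finite_subset) simp
  then show ?thesis
    unfolding min_hamming_dist_def using assms by (intro Min_le) auto
qed

lemma hamming_ball_unique:
  fixes C :: "('a::finite ^ 'n) set"
  assumes "x \<in> C" "y \<in> C" "2 * r < min_hamming_dist C"
    and "hamming_dist w x \<le> r" "hamming_dist w y \<le> r"
  shows "x = y"
proof (rule ccontr)
  assume "x \<noteq> y"
  with assms have "min_hamming_dist C \<le> hamming_dist x y"
    by (intro min_hamming_dist_le)
  also have "\<dots> \<le> hamming_dist w x + hamming_dist w y"
    using hamming_dist_triangle[of x y w] by (simp add: hamming_dist_commute)
  finally show False
    using assms by linarith
qed

text \<open>Links the dimension \<open>k\<close> to the number \<open>q ^ k\<close> of messages:
  coordinates with respect to a basis put the subspace in bijection with the functions from the
  basis to the field.\<close>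

lemma card_subspace:
  fixes C :: "('a::{field,finite} ^ 'n) set"
  assumes "vec.subspace C"
  shows "card C = CARD('a) ^ vec.dim C"
proof -
  obtain B where B: "B \<subseteq> C" "vec.independent B" "C \<subseteq> vec.span B" "card B = vec.dim C"
    using vec.basis_exists[of C] by blast
  define comb where "comb = (\<lambda>f. \<Sum>b\<in>B. f b *s b)"
  \<comment> \<open>Extensional functions are fixed by their values on \<open>B\<close>. Without
    this restriction, coefficients outside \<open>B\<close> would destroy injectivity and the
    count.\<close>
  have "inj_on comb (B \<rightarrow>\<^sub>E UNIV)"
  proof (rule inj_onI)
    fix f g
    assume f: "f \<in> B \<rightarrow>\<^sub>E UNIV" and g: "g \<in> B \<rightarrow>\<^sub>E UNIV" and "comb f = comb g"
    then have "(\<Sum>b\<in>B. (f b - g b) *s b) = 0"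
      by (simp add: comb_def vec.scale_left_diff_distrib sum_subtractf)
    then have "f b - g b = 0" if "b \<in> B" for b
      using vec.independentD[OF B(2), of B "\<lambda>b. f b - g b"] that by simp
    with f g show "f = g"
      by (intro PiE_ext[OF f g]) simp
  qed
  moreover have "comb ` (B \<rightarrow>\<^sub>E UNIV) = C"
  proof -
    \<comment> \<open>\<open>vec.span_finite\<close> ranges over all coefficient functions;
      restricting one to \<open>B\<close> leaves its linear combination unchanged.\<close>
    have "comb ` (B \<rightarrow>\<^sub>E UNIV) = range comb"
    proof (intro equalityI subsetI)
      fix x assume "x \<in> range comb"
      then obtain f where "x = comb (restrict f B)"
        by (auto simp: comb_def)
      then show "x \<in> comb ` (B \<rightarrow>\<^sub>E UNIV)"
        by auto
    qed auto
    also have "\<dots> = vec.span B"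
      by (simp add: comb_def vec.span_finite)
    also have "\<dots> = C"
      using B assms vec.span_subspace by blast
    finally show ?thesis .
  qed
  ultimately have "card C = card (B \<rightarrow>\<^sub>E (UNIV :: 'a set))"
    using card_image by blast
  with B(4) show ?thesis
    by (simp add: card_PiE)
qed

text \<open>Off \<open>\<phi>\<close> and the support of \<open>e\<close>, the received word agrees
  with \<open>c'\<close>. Errors may also hit masked cells, so the two sets can overlap and the
  union bound is used.\<close>

lemma hamming_dist_masked_error_le:
  fixes c c' e :: "'a::group_add ^ 'n"
  assumes "\<And>i. i \<notin> \<phi> \<Longrightarrow> c $ i = c' $ i"
  shows "hamming_dist (c + e) c' \<le> hamming_weight e + card \<phi>"
proof -
  have "{i. (c + e) $ i \<noteq> c' $ i} \<subseteq> {i. e $ i \<noteq> 0} \<union> \<phi>"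
    using assms by auto
  then have "card {i. (c + e) $ i \<noteq> c' $ i} \<le> card ({i. e $ i \<noteq> 0} \<union> \<phi>)"
    by (intro card_mono) auto
  also have "\<dots> \<le> card {i. e $ i \<noteq> 0} + card \<phi>"
    by (rule card_Un_le)
  finally show ?thesis
    unfolding hamming_dist_def hamming_weight_def .
qed

theorem proposition3:
  fixes C :: "('a::{field,finite} ^ 'n) set"
    and Msgs :: "'m set"
    and codeword :: "'m \<Rightarrow> 'a ^ 'n"
    and Enc :: "'n set \<Rightarrow> 'm \<Rightarrow> 'a ^ 'n"
    and q n k d u t :: nat
  assumes "n \<ge> 1" and "k \<ge> 1" and "u \<le> n" and "t \<le> n" and "u + t < n"
    and "linear_code q n k d C"
    and "d \<ge> 2 * (t + u) + 1"
    and "bij_betw codeword Msgs C"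
    and "\<And>\<phi> m i. card \<phi> = u \<Longrightarrow> m \<in> Msgs \<Longrightarrow> i \<notin> \<phi> \<Longrightarrow> Enc \<phi> m $ i = codeword m $ i"
    and "\<And>\<phi> m e i. card \<phi> = u \<Longrightarrow> m \<in> Msgs \<Longrightarrow> admissible_error t e \<Longrightarrow> i \<in> \<phi> \<Longrightarrow>
           Enc \<phi> m $ i + e $ i \<noteq> 0"
  shows "\<exists>Dec. PDMC n (q ^ k) q u t Msgs Enc Dec"
proof -
  note code = \<open>linear_code q n k d C\<close>[unfolded linear_code_def]
  note bij = \<open>bij_betw codeword Msgs C\<close>
  \<comment> \<open>Bounded-distance decoding, stated on messages rather than codewords. Words
    outside every ball get an unspecified value, which is harmless since \<open>PDMC\<close>
    constrains \<open>Dec\<close> only on words \<open>Enc \<phi> m + e\<close>.\<close>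
  define Dec where "Dec w = (THE m. m \<in> Msgs \<and> hamming_dist w (codeword m) \<le> t + u)" for w
  have "Dec (Enc \<phi> m + e) = m"
    if "card \<phi> = u" "m \<in> Msgs" "admissible_error t e" for \<phi> m e
    unfolding Dec_def
  proof (rule the_equality)
    have "hamming_dist (Enc \<phi> m + e) (codeword m) \<le> hamming_weight e + card \<phi>"
      using assms(9) that by (intro hamming_dist_masked_error_le)
    with that have close: "hamming_dist (Enc \<phi> m + e) (codeword m) \<le> t + u"
      by (simp add: admissible_error_def)
    with that show "m \<in> Msgs \<and> hamming_dist (Enc \<phi> m + e) (codeword m) \<le> t + u"
      by simp
    fix m'
    assume m': "m' \<in> Msgs \<and> hamming_dist (Enc \<phi> m + e) (codeword m') \<le> t + u"
    \<comment> \<open>Disjoint balls identify only the codeword; injectivity of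
      \<open>codeword\<close> on \<open>Msgs\<close> then recovers the message.\<close>
    have "codeword m' = codeword m"
    proof (rule hamming_ball_unique)
      show "2 * (t + u) < min_hamming_dist C"
        using code assms(7) by simp
    qed (use m' close that bij_betwE[OF bij] in auto)
    with m' that show "m' = m"
      using bij by (auto simp: bij_betw_def dest: inj_onD)
  qed
  moreover have "finite Msgs"
    using bij_betw_finite[OF bij] by simp
  moreover have "card Msgs = q ^ k"
    using bij_betw_same_card[OF bij] card_subspace[of C] code by auto
  ultimately have "PDMC n (q ^ k) q u t Msgs Enc Dec"
    unfolding PDMC_def using code assms(10) by blast
  then show ?thesis
    by blast
qed

end
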